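(* Let $f:I\subseteq\mathbb{R}\to\mathbb{R}$, where $I$ is a neighborhood of a root $\alpha$ of $f$, be differentiable at $\alpha$ with $\Gamma=f'(\alpha)\neq 0$. Let $\{x_n\}$ be a sequence in $I$ converging to $\alpha$, generated by a one-point iterative method with memory for the equation $f(x)=0$. Let $e_n=x_n-\alpha$, with $e_n\neq 0$, and suppose that $$|e_{n+1}| = |C|\,|e_n|^{\rho}\,\bigl(1+O(|e_n|^{\sigma})\bigr)\qquad (n\to\infty),$$ where $C\neq 0$ is a real constant, $0<\sigma<1$ and $\rho\ge (1+\sqrt5)/2$ (so $\rho$ is the order of convergence). Let $$\breve{\lambda}_n=\frac{\log|f(x_n)|}{\log|f(x_{n-1})|}$$ be the Petković computational local order of convergence (PCLOC). Then $$\breve{\lambda}_n\approx\rho\left(1+O\!\left(\frac{\log\bigl(|C|\,|\Gamma|^{1-\rho}\bigr)}{\rho\,\log|e_{n-1}|}\right)\right).$$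
   Context: A one-point iterative method with memory for solving $f(x)=0$ is an iteration $x_{n+1}=\phi(x_n;x_{n-1},\dots,x_{n-j})$, $n\ge 0$, where $\phi$ is the iteration function; the case without memory ($j=0$) is allowed. The quantity $\breve\lambda_n$ is considered for iterates near the root, i.e. for $n$ large enough. The notation $a_n\approx b_n$ means $\lim_{n\to\infty} a_n/b_n=1$; the $O$-term is for $n\to\infty$. *)

theory Defs
  imports "HOL-Analysis.Analysis" "HOL-Library.Landau_Symbols"
begin

text \<open>
  The iteration function \<open>\<phi>\<close> takes the current iterate and the list of the \<open>j\<close> preceding ones,
  most recent first. The sequence is indexed so that its starting values are \<open>x 0, \<dots>, x j\<close>
  (rather than \<open>x\<^sub>-\<^sub>j, \<dots>, x\<^sub>0\<close>); for \<open>j = 0\<close> this is the case without memory.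
\<close>
definition one_point_iteration ::
    "nat \<Rightarrow> (real \<Rightarrow> real list \<Rightarrow> real) \<Rightarrow> (nat \<Rightarrow> real) \<Rightarrow> bool" where
  "one_point_iteration j \<phi> x \<longleftrightarrow>
     (\<forall>n\<ge>j. x (Suc n) = \<phi> (x n) (map (\<lambda>i. x (n - i)) [1..<Suc j]))"

text \<open>The Petkovic computational local order of convergence; it is meaningful only for
  \<open>n \<ge> 1\<close> large enough.\<close>
definition pcloc :: "(real \<Rightarrow> real) \<Rightarrow> (nat \<Rightarrow> real) \<Rightarrow> nat \<Rightarrow> real" where
  "pcloc f x n = ln \<bar>f (x n)\<bar> / ln \<bar>f (x (n - 1))\<bar>"

end

theory Submission
  imports Defs
begin

text \<open>
  On a logarithmic scale the error equation is affine: with \<open>L n = ln \<bar>e n\<bar>\<close> it says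
  \<open>L (n + 1) = \<rho> * L n + ln \<bar>C\<bar> + o(1)\<close>, and differentiability of \<open>f\<close> at the simple root gives
  \<open>F n = ln \<bar>f (x n)\<bar> = L n + ln \<bar>\<Gamma>\<bar> + o(1)\<close>. Eliminating \<open>L\<close> yields
  \<open>F (n + 1) = \<rho> * F n + K + o(1)\<close> with
  \<open>K = ln \<bar>C\<bar> + (1 - \<rho>) * ln \<bar>\<Gamma>\<bar> = ln (\<bar>C\<bar> * \<bar>\<Gamma>\<bar> powr (1 - \<rho>))\<close>.
  Dividing by \<open>F n\<close>, which is asymptotic to \<open>L n\<close> and tends to \<open>-\<infinity>\<close>, one obtains
  \<open>F (n + 1) / F n = \<rho> + (K + o(1)) / L n\<close>: the leading relative error of the PCLOC is
  \<open>K / (\<rho> * L n)\<close>. The lemma \<open>ratio_of_affine_recurrence\<close> is this computation for abstract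
  sequences; \<open>log_error_recurrence\<close> and \<open>log_residual_minus_log_error\<close> supply its hypotheses.

  The theorem then holds with \<open>r\<close> equal to that leading term: both sides tend to \<open>\<rho> > 0\<close>, so
  they are asymptotic to each other. For \<open>K \<noteq> 0\<close> even an eventual equality
  \<open>pcloc f x n = \<rho> * (1 + r n)\<close> is possible with some \<open>r\<close> in the stated \<open>O\<close>-class. For \<open>K = 0\<close>
  that class contains only sequences that vanish eventually, and the asymptotic equivalence
  absorbs the remaining error \<open>o(1 / L n)\<close>.
\<close>

text \<open>
  The offset \<open>F - L\<close>, with limit \<open>g\<close>, enters the recurrence of \<open>F\<close> twice, with the factors
  \<open>1\<close> and \<open>-\<rho>\<close>; hence the term \<open>(1 - \<rho>) * g\<close>.
\<close>
lemma ratio_of_affine_recurrence: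
  fixes F L :: "nat \<Rightarrow> real"
  assumes L: "filterlim L at_bot sequentially"
    and FL: "(\<lambda>n. F n - L n) \<longlonglongrightarrow> g"
    and rec: "(\<lambda>n. L (Suc n) - \<rho> * L n) \<longlonglongrightarrow> c"
  shows "(\<lambda>n. (F (Suc n) / F n - \<rho>) * L n) \<longlonglongrightarrow> c + (1 - \<rho>) * g"
proof -
  have L0: "\<forall>\<^sub>F n in sequentially. L n < 0"
    using L by (simp add: filterlim_at_bot_dense)
  have "(\<lambda>n. 1 + (F n - L n) / L n) \<longlonglongrightarrow> 1 + 0"
    by (intro tendsto_add tendsto_const tendsto_divide_0[OF FL] filterlim_at_bot_imp_at_infinity L)
  moreover have "\<forall>\<^sub>F n in sequentially. 1 + (F n - L n) / L n = F n / L n"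
    using L0 by eventually_elim (simp add: field_simps)
  ultimately have FdivL: "(\<lambda>n. F n / L n) \<longlonglongrightarrow> 1"
    using Lim_transform_eventually by fastforce
  then have LdivF: "(\<lambda>n. L n / F n) \<longlonglongrightarrow> 1"
    using tendsto_inverse[OF FdivL] by (simp add: inverse_eq_divide)
  have F0: "\<forall>\<^sub>F n in sequentially. F n \<noteq> 0"
    using tendsto_imp_eventually_ne[OF FdivL zero_neq_one[symmetric]] by eventually_elim auto
  have FL_Suc: "(\<lambda>n. F (Suc n) - L (Suc n)) \<longlonglongrightarrow> g"
    using FL by (rule LIMSEQ_Suc)
  have "(\<lambda>n. ((F (Suc n) - L (Suc n)) - \<rho> * (F n - L n) + (L (Suc n) - \<rho> * L n)) * (L n / F n))
      \<longlonglongrightarrow> (g - \<rho> * g + c) * 1"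
    by (intro tendsto_intros FL FL_Suc rec LdivF)
  moreover have "\<forall>\<^sub>F n in sequentially.
      ((F (Suc n) - L (Suc n)) - \<rho> * (F n - L n) + (L (Suc n) - \<rho> * L n)) * (L n / F n)
      = (F (Suc n) / F n - \<rho>) * L n"
    using F0 by eventually_elim (simp add: field_simps)
  ultimately have "(\<lambda>n. (F (Suc n) / F n - \<rho>) * L n) \<longlonglongrightarrow> (g - \<rho> * g + c) * 1"
    by (rule Lim_transform_eventually)
  then show ?thesis
    by (simp add: algebra_simps)
qed

lemma ln_abs_null_sequence:
  fixes e :: "nat \<Rightarrow> real"
  assumes "e \<longlonglongrightarrow> 0" and "\<And>n. e n \<noteq> 0"
  shows "filterlim (\<lambda>n. ln \<bar>e n\<bar>) at_bot sequentially"
proof (rule filterlim_compose[OF ln_at_0])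
  show "filterlim (\<lambda>n. \<bar>e n\<bar>) (at_right 0) sequentially"
    using assms by (auto simp: filterlim_at intro: tendsto_rabs_zero)
qed

text \<open>The \<open>O\<close>-term of the error equation tends to \<open>0\<close>, so its logarithm disappears in the limit.\<close>
lemma log_error_recurrence:
  fixes e r :: "nat \<Rightarrow> real"
  assumes e: "e \<longlonglongrightarrow> 0" "\<And>n. e n \<noteq> 0" and "C \<noteq> 0" and "0 < \<sigma>"
    and r: "r \<in> O(\<lambda>n. \<bar>e n\<bar> powr \<sigma>)"
    and eq: "\<forall>\<^sub>F n in sequentially. \<bar>e (Suc n)\<bar> = \<bar>C\<bar> * \<bar>e n\<bar> powr \<rho> * (1 + r n)"
  shows "(\<lambda>n. ln \<bar>e (Suc n)\<bar> - \<rho> * ln \<bar>e n\<bar>) \<longlonglongrightarrow> ln \<bar>C\<bar>"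
proof -
  have "(\<lambda>n. \<bar>e n\<bar> powr \<sigma>) \<longlonglongrightarrow> 0 powr \<sigma>"
    using e \<open>0 < \<sigma>\<close> by (intro tendsto_powr2 tendsto_const) (auto intro: tendsto_rabs_zero)
  then have "(\<lambda>n. \<bar>e n\<bar> powr \<sigma>) \<in> o(\<lambda>_. 1)"
    by (intro smalloI_tendsto) simp_all
  then have "r \<in> o(\<lambda>_. 1)"
    using r by (rule landau_o.big_small_trans[rotated])
  then have r0: "r \<longlonglongrightarrow> 0"
    using smalloD_tendsto by fastforce
  have "\<forall>\<^sub>F n in sequentially. r n > -1"
    using r0 by (rule order_tendstoD) simp
  with eq have "\<forall>\<^sub>F n in sequentially.
      ln \<bar>C\<bar> + ln (1 + r n) = ln \<bar>e (Suc n)\<bar> - \<rho> * ln \<bar>e n\<bar>"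
  proof eventually_elim
    case (elim n)
    then show ?case
      using \<open>C \<noteq> 0\<close> e(2)[of n] by (simp add: ln_mult)
  qed
  moreover have "(\<lambda>n. ln \<bar>C\<bar> + ln (1 + r n)) \<longlonglongrightarrow> ln \<bar>C\<bar> + ln (1 + 0)"
    by (intro tendsto_intros r0) simp
  ultimately show ?thesis
    using Lim_transform_eventually by fastforce
qed

text \<open>
  At a simple root the residual is proportional to the error, with factor tending to the
  derivative. As that is nonzero, the logarithm of the factor converges as well.
\<close>
lemma log_residual_minus_log_error:
  fixes f :: "real \<Rightarrow> real" and x :: "nat \<Rightarrow> real"
  assumes "f \<alpha> = 0" and deriv: "(f has_real_derivative \<Gamma>) (at \<alpha> within I)" and "\<Gamma> \<noteq> 0"
    and x: "\<And>n. x n \<in> I" "x \<longlonglongrightarrow> \<alpha>" "\<And>n. x n \<noteq> \<alpha>"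
  shows "(\<lambda>n. ln \<bar>f (x n)\<bar> - ln \<bar>x n - \<alpha>\<bar>) \<longlonglongrightarrow> ln \<bar>\<Gamma>\<bar>"
proof -
  have "filterlim x (at \<alpha> within I) sequentially"
    using x by (simp add: filterlim_at)
  from filterlim_compose[OF deriv[unfolded has_field_derivative_iff] this]
  have quot: "(\<lambda>n. f (x n) / (x n - \<alpha>)) \<longlonglongrightarrow> \<Gamma>"
    by (simp add: \<open>f \<alpha> = 0\<close>)
  then have "\<forall>\<^sub>F n in sequentially. f (x n) / (x n - \<alpha>) \<noteq> 0"
    using \<open>\<Gamma> \<noteq> 0\<close> by (rule tendsto_imp_eventually_ne)
  then have "\<forall>\<^sub>F n in sequentially.
      ln \<bar>f (x n) / (x n - \<alpha>)\<bar> = ln \<bar>f (x n)\<bar> - ln \<bar>x n - \<alpha>\<bar>"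
    by eventually_elim (simp add: ln_div)
  moreover have "(\<lambda>n. ln \<bar>f (x n) / (x n - \<alpha>)\<bar>) \<longlonglongrightarrow> ln \<bar>\<Gamma>\<bar>"
    using \<open>\<Gamma> \<noteq> 0\<close> by (intro tendsto_ln tendsto_rabs quot) simp
  ultimately show ?thesis
    by (rule Lim_transform_eventually[rotated])
qed

theorem proposition6p1:
  fixes f :: "real \<Rightarrow> real" and I :: "real set" and \<alpha> \<Gamma> C \<rho> \<sigma> :: real
    and \<phi> :: "real \<Rightarrow> real list \<Rightarrow> real" and j :: nat and x e :: "nat \<Rightarrow> real"
  assumes "\<alpha> \<in> interior I"
    and "f \<alpha> = 0"
    and "(f has_real_derivative \<Gamma>) (at \<alpha> within I)"
    and "\<Gamma> \<noteq> 0"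
    and "one_point_iteration j \<phi> x"
    and "\<And>n. x n \<in> I"
    and "x \<longlonglongrightarrow> \<alpha>"
    and "\<And>n. e n = x n - \<alpha>"
    and "\<And>n. e n \<noteq> 0"
    and "C \<noteq> 0"
    and "0 < \<sigma>" "\<sigma> < 1"
    and "\<rho> \<ge> (1 + sqrt 5) / 2"
    and "\<exists>r. r \<in> O(\<lambda>n. \<bar>e n\<bar> powr \<sigma>) \<and>
           (\<forall>\<^sub>F n in sequentially. \<bar>e (Suc n)\<bar> = \<bar>C\<bar> * \<bar>e n\<bar> powr \<rho> * (1 + r n))"
  shows "\<exists>r. r \<in> O(\<lambda>n. ln (\<bar>C\<bar> * \<bar>\<Gamma>\<bar> powr (1 - \<rho>)) / (\<rho> * ln \<bar>e (n - 1)\<bar>)) \<and>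
           pcloc f x \<sim>[sequentially] (\<lambda>n. \<rho> * (1 + r n))"
proof -
  define L where "L n = ln \<bar>e n\<bar>" for n
  define K where "K = ln (\<bar>C\<bar> * \<bar>\<Gamma>\<bar> powr (1 - \<rho>))"
  define r where "r n = K / (\<rho> * L (n - 1))" for n
  have "0 < (1 + sqrt 5) / 2"
    by (simp add: add_pos_pos)
  then have \<rho>: "\<rho> > 0"
    using assms(13) by linarith
  have x_e: "x n - \<alpha> = e n" "x n \<noteq> \<alpha>" for n
    using assms(8,9)[of n] by auto
  have e0: "e \<longlonglongrightarrow> 0"
    using LIM_zero[OF assms(7)] by (simp add: x_e)
  have L_at_bot: "filterlim L at_bot sequentially"
    unfolding L_def using e0 assms(9) by (rule ln_abs_null_sequence)
  have residual: "(\<lambda>n. ln \<bar>f (x n)\<bar> - L n) \<longlonglongrightarrow> ln \<bar>\<Gamma>\<bar>"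
    using log_residual_minus_log_error[OF assms(2,3,4,6,7) x_e(2)] by (simp add: x_e(1) L_def)
  have error: "(\<lambda>n. L (Suc n) - \<rho> * L n) \<longlonglongrightarrow> ln \<bar>C\<bar>"
    unfolding L_def using assms(14) log_error_recurrence[OF e0 assms(9,10,11)] by blast
  have K: "K = ln \<bar>C\<bar> + (1 - \<rho>) * ln \<bar>\<Gamma>\<bar>"
    using assms(4,10) by (simp add: K_def ln_mult ln_powr)
  have first_order: "(\<lambda>n. (pcloc f x (Suc n) - \<rho>) * L n) \<longlonglongrightarrow> K"
    using ratio_of_affine_recurrence[OF L_at_bot residual error] by (simp add: pcloc_def K)
  have L_infinity: "filterlim L at_infinity sequentially"
    using L_at_bot by (rule filterlim_at_bot_imp_at_infinity)
  have "\<forall>\<^sub>F n in sequentially. L n < 0"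
    using L_at_bot by (simp add: filterlim_at_bot_dense)
  then have "\<forall>\<^sub>F n in sequentially. (pcloc f x (Suc n) - \<rho>) * L n / L n = pcloc f x (Suc n) - \<rho>"
    by eventually_elim simp
  moreover have "(\<lambda>n. (pcloc f x (Suc n) - \<rho>) * L n / L n) \<longlonglongrightarrow> 0"
    by (rule tendsto_divide_0[OF first_order L_infinity])
  ultimately have "(\<lambda>n. pcloc f x (Suc n) - \<rho>) \<longlonglongrightarrow> 0"
    by (rule Lim_transform_eventually[rotated])
  then have pcloc_lim: "pcloc f x \<longlonglongrightarrow> \<rho>"
    by (simp add: LIM_zero_iff filterlim_sequentially_Suc)
  have "(\<lambda>n. K / \<rho> / L n) \<longlonglongrightarrow> 0"
    by (rule tendsto_divide_0[OF tendsto_const L_infinity])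
  then have "(\<lambda>n. r (Suc n)) \<longlonglongrightarrow> 0"
    by (simp add: r_def)
  then have r_lim: "r \<longlonglongrightarrow> 0"
    by (simp add: filterlim_sequentially_Suc)
  have "(\<lambda>n. \<rho> * (1 + r n)) \<longlonglongrightarrow> \<rho> * (1 + 0)"
    by (intro tendsto_intros r_lim)
  then have model_lim: "(\<lambda>n. \<rho> * (1 + r n)) \<longlonglongrightarrow> \<rho>"
    by simp
  have "pcloc f x \<sim>[sequentially] (\<lambda>n. \<rho> * (1 + r n))"
    using asymp_equiv_trans[OF tendsto_imp_asymp_equiv_const[OF pcloc_lim]
        asymp_equiv_symI[OF tendsto_imp_asymp_equiv_const[OF model_lim]]] \<rho> by simp
  moreover have "r \<in> O(\<lambda>n. ln (\<bar>C\<bar> * \<bar>\<Gamma>\<bar> powr (1 - \<rho>)) / (\<rho> * ln \<bar>e (n - 1)\<bar>))"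
    by (simp add: r_def[abs_def] K_def L_def)
  ultimately show ?thesis
    by blast
qed

end
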